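(* Let $G$ be a graph with $n$ vertices and $m$ edges, let $\mathcal{S}=\mathcal{S}(G)$ be its Sombor matrix and $F=\sum_{i=1}^n d_i^3$. Then $$EE(G)\leq n-1+\frac{\operatorname{tr}(\mathcal{S}^3)}{6}+\frac{\operatorname{tr}(\mathcal{S}^4)}{24}+e^{\sqrt{2F}}-\sqrt{2F}-\frac{1}{3}F\sqrt{2F}-\frac{1}{6}F^2.$$ Equality holds if and only if $G$ is an empty (edgeless) graph.
   Context: $G$ is a simple undirected graph on vertices $v_1,\dots,v_n$ with degrees $d_i$. The Sombor matrix $\mathcal{S}(G)$ has $(i,j)$-entry $\sqrt{d_i^2+d_j^2}$ if $v_i,v_j$ are adjacent and $0$ otherwise, with eigenvalues $\rho_1,\dots,\rho_n$. The Sombor Estrada index is $EE(G)=\sum_{i=1}^n e^{\rho_i}$. *)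

theory Defs
  imports Complex_Main "HOL-Library.Multiset" "HOL-Computational_Algebra.Polynomial"
    "HOL-Computational_Algebra.Fundamental_Theorem_Algebra"
    "Jordan_Normal_Form.Char_Poly"
begin

text \<open>A simple undirected graph is given by the list \<open>vs\<close> of its vertices
  \<open>v\<^sub>1, \<dots>, v\<^sub>n\<close> and the set \<open>E\<close> of its edges, which are two-element sets of vertices.\<close>

definition simple_graph :: "'a list \<Rightarrow> 'a set set \<Rightarrow> bool" where
  "simple_graph vs E \<longleftrightarrow> distinct vs \<and> (\<forall>e\<in>E. e \<subseteq> set vs \<and> card e = 2)"

definition degr :: "'a set set \<Rightarrow> 'a \<Rightarrow> nat" where
  "degr E v = card {e \<in> E. v \<in> e}"

definition sombor_matrix :: "'a list \<Rightarrow> 'a set set \<Rightarrow> real mat" where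
  "sombor_matrix vs E = mat (length vs) (length vs) (\<lambda>(i, j).
     if {vs ! i, vs ! j} \<in> E
     then sqrt ((real (degr E (vs ! i)))\<^sup>2 + (real (degr E (vs ! j)))\<^sup>2) else 0)"

definition mat_trace :: "'a :: comm_monoid_add mat \<Rightarrow> 'a" where
  "mat_trace A = (\<Sum>i<dim_row A. A $$ (i, i))"

text \<open>The eigenvalues are taken with algebraic multiplicity, as the multiset of roots of the
  characteristic polynomial. Working over the reals loses none of them because the Sombor matrix
  is symmetric; see \<open>size_sombor_eigenvalues\<close> below.\<close>

definition sombor_eigenvalues :: "'a list \<Rightarrow> 'a set set \<Rightarrow> real multiset" where
  "sombor_eigenvalues vs E = proots (char_poly (sombor_matrix vs E))"

definition sombor_estrada :: "'a list \<Rightarrow> 'a set set \<Rightarrow> real" where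
  "sombor_estrada vs E = (\<Sum>\<rho>\<in>#sombor_eigenvalues vs E. exp \<rho>)"

lemma size_proots_real_rooted:
  fixes p :: "real poly"
  assumes "p \<noteq> 0" and "\<And>z. poly (map_poly complex_of_real p) z = 0 \<Longrightarrow> z \<in> \<real>"
  shows "size (proots p) = degree p"
  using assms
proof (induction "degree p" arbitrary: p)
  case 0
  then obtain c where "p = [:c:]" "c \<noteq> 0" by (metis degree_eq_zeroE pCons_0_0)
  then show ?case by simp
next
  case (Suc k)
  have "\<not> constant (poly (map_poly complex_of_real p))"
    using Suc.hyps(2) by (simp add: constant_degree)
  then obtain z where z: "poly (map_poly complex_of_real p) z = 0"
    using fundamental_theorem_of_algebra by blast
  then obtain r where r: "z = of_real r" using Suc.prems(2) by (auto elim: Reals_cases)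
  have "poly p r = 0" using z by (simp add: r)
  then obtain q where q: "p = [:-r, 1:] * q" by (auto simp: poly_eq_0_iff_dvd dvd_def)
  have "q \<noteq> 0" using Suc.prems(1) q by auto
  have deg: "degree p = Suc (degree q)" unfolding q using \<open>q \<noteq> 0\<close> by (subst degree_mult_eq) auto
  have "z \<in> \<real>" if "poly (map_poly complex_of_real q) z = 0" for z
  proof (rule Suc.prems(2))
    have "map_poly complex_of_real p = map_poly of_real [:-r, 1:] * map_poly of_real q"
      unfolding q by (rule poly_eqI) (simp add: coeff_map_poly coeff_pCons split: nat.split)
    then show "poly (map_poly complex_of_real p) z = 0" using that by simp
  qed
  then have "size (proots q) = degree q" using Suc.hyps(1)[of q] Suc.hyps(2) deg \<open>q \<noteq> 0\<close> by auto
  moreover have "proots p = proots [:-r, 1:] + proots q"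
    unfolding q using \<open>q \<noteq> 0\<close> by (intro proots_mult) auto
  ultimately show ?case by (simp add: deg)
qed

lemma eigenvalue_real_symmetric:
  fixes A :: "real mat"
  assumes A: "A \<in> carrier_mat n n" and sym: "\<And>i j. i < n \<Longrightarrow> j < n \<Longrightarrow> A $$ (i, j) = A $$ (j, i)"
    and ev: "eigenvalue (map_mat complex_of_real A) k"
  shows "k \<in> \<real>"
proof -
  obtain v where v: "v \<in> carrier_vec n" "v \<noteq> 0\<^sub>v n" "map_mat complex_of_real A *\<^sub>v v = k \<cdot>\<^sub>v v"
    using ev A unfolding eigenvalue_def eigenvector_def by auto
  have row: "(\<Sum>j<n. of_real (A $$ (i, j)) * v $ j) = k * v $ i" if "i < n" for i
  proof -
    have "(map_mat complex_of_real A *\<^sub>v v) $ i = (\<Sum>j<n. of_real (A $$ (i, j)) * v $ j)"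
      using that A v(1) by (auto simp: scalar_prod_def atLeast0LessThan intro!: sum.cong)
    then show ?thesis using v(1,3) that by simp
  qed
  define Q where "Q = (\<Sum>i<n. \<Sum>j<n. of_real (A $$ (i, j)) * v $ j * cnj (v $ i))"
  define N where "N = (\<Sum>i<n. (cmod (v $ i))\<^sup>2)"
  have "Q = (\<Sum>i<n. (k * v $ i) * cnj (v $ i))"
    unfolding Q_def by (rule sum.cong) (simp_all add: sum_distrib_right flip: row)
  also have "\<dots> = k * of_real N"
    by (simp add: N_def sum_distrib_left mult.assoc complex_norm_square flip: of_real_power)
  finally have Q: "Q = k * of_real N" .
  have "cnj Q = (\<Sum>i<n. \<Sum>j<n. of_real (A $$ (i, j)) * cnj (v $ j) * v $ i)"
    by (simp add: Q_def)
  also have "\<dots> = (\<Sum>j<n. \<Sum>i<n. of_real (A $$ (i, j)) * cnj (v $ j) * v $ i)"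
    by (rule sum.swap)
  also have "\<dots> = Q"
    unfolding Q_def by (intro sum.cong refl) (use sym in auto)
  finally have "Q \<in> \<real>" by (simp add: Reals_cnj_iff)
  moreover have "N \<noteq> 0"
  proof
    assume "N = 0"
    then have "\<forall>i\<in>{..<n}. (cmod (v $ i))\<^sup>2 = 0"
      unfolding N_def by (subst (asm) sum_nonneg_eq_0_iff) auto
    then have "v = 0\<^sub>v n" using v(1) by (intro eq_vecI) auto
    then show False using v(2) by simp
  qed
  ultimately have "Q / of_real N \<in> \<real>" by (intro Reals_divide) auto
  then show ?thesis using Q \<open>N \<noteq> 0\<close> by simp
qed

lemma size_sombor_eigenvalues: "size (sombor_eigenvalues vs E) = length vs"
proof -
  let ?A = "sombor_matrix vs E"
  have A: "?A \<in> carrier_mat (length vs) (length vs)" by (simp add: sombor_matrix_def)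
  have sym: "?A $$ (i, j) = ?A $$ (j, i)" if "i < length vs" "j < length vs" for i j
    using that by (simp add: sombor_matrix_def insert_commute add.commute)
  have cA: "map_mat complex_of_real ?A \<in> carrier_mat (length vs) (length vs)" using A by simp
  have "z \<in> \<real>" if "poly (map_poly complex_of_real (char_poly ?A)) z = 0" for z
    using that eigenvalue_real_symmetric[OF A sym, of z] eigenvalue_root_char_poly[OF cA, of z]
    by (simp add: of_real_hom.char_poly_hom[OF A])
  then have "size (proots (char_poly ?A)) = degree (char_poly ?A)"
    using degree_monic_char_poly[OF A] by (intro size_proots_real_rooted) auto
  then show ?thesis using degree_monic_char_poly[OF A] by (simp add: sombor_eigenvalues_def)
qed

end

theory Submission
  imports Defs "Jordan_Normal_Form.Schur_Decomposition"
begin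

text \<open>By Schur triangularisation the power sums of the eigenvalues are the traces of the powers of
  the matrix; in particular the eigenvalues sum to \<open>0\<close> and their squares sum to \<open>s\<^sup>2 = 2F\<close>.
  Let \<open>g\<close> be the exponential series without its first five terms. Since every eigenvalue satisfies
  \<open>\<bar>x\<bar> \<le> s\<close>, comparing \<open>x^k \<le> x\<^sup>2 s^(k-2)\<close> term by term gives \<open>s\<^sup>2 g(x) \<le> x\<^sup>2 g(s)\<close>, and summing over
  the eigenvalues yields the bound. A graph with an edge has a negative eigenvalue, for which the
  comparison of the terms with \<open>k = 5\<close> is strict.\<close>

section \<open>Traces and eigenvalues\<close>

text \<open>This converts a count of roots into the linear factorisation that Schur decomposition
  asks for. While the degree is positive the count supplies a root, and dividing by its factor
  lowers count and degree by one and keeps the leading coefficient.\<close>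

lemma poly_eq_prod_proots:
  fixes p :: "'a :: field poly"
  assumes "p \<noteq> 0" and "size (proots p) = degree p"
  shows "p = Polynomial.smult (lead_coeff p) (\<Prod>x\<in>#proots p. [:-x, 1:])"
  using assms
proof (induction "degree p" arbitrary: p)
  case 0
  then obtain c where "p = [:c:]" by (metis degree_eq_zeroE)
  then show ?case by simp
next
  case (Suc k)
  then obtain x where "x \<in># proots p" by (metis Zero_not_Suc multiset_nonemptyE size_empty)
  then have "poly p x = 0" using Suc.prems(1) by simp
  then obtain q where q: "p = [:-x, 1:] * q" by (auto simp: poly_eq_0_iff_dvd dvd_def)
  have "q \<noteq> 0" using Suc.prems(1) q by auto
  have deg: "degree p = Suc (degree q)" unfolding q using \<open>q \<noteq> 0\<close> by (subst degree_mult_eq) auto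
  have roots: "proots p = add_mset x (proots q)"
    unfolding q using \<open>q \<noteq> 0\<close> by (subst proots_mult) auto
  have "q = Polynomial.smult (lead_coeff q) (\<Prod>x\<in>#proots q. [:-x, 1:])"
    using Suc.hyps Suc.prems(2) deg roots \<open>q \<noteq> 0\<close> by auto
  moreover have "lead_coeff p = lead_coeff q" unfolding q lead_coeff_mult by simp
  ultimately show ?case unfolding roots
    by (metis (no_types, lifting) image_mset_add_mset mult_smult_right prod_mset.add_mset q)
qed

lemma mat_trace_mult_commute:
  fixes A B :: "'a :: comm_semiring_0 mat"
  assumes "A \<in> carrier_mat n m" and "B \<in> carrier_mat m n"
  shows "mat_trace (A * B) = mat_trace (B * A)"
proof -
  have "mat_trace (A * B) = (\<Sum>i<n. \<Sum>j<m. A $$ (i, j) * B $$ (j, i))"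
    using assms by (auto simp: mat_trace_def scalar_prod_def atLeast0LessThan intro!: sum.cong)
  also have "\<dots> = (\<Sum>j<m. \<Sum>i<n. B $$ (j, i) * A $$ (i, j))"
    by (subst sum.swap) (simp add: mult.commute)
  also have "\<dots> = mat_trace (B * A)"
    using assms by (auto simp: mat_trace_def scalar_prod_def atLeast0LessThan intro!: sum.cong)
  finally show ?thesis .
qed

lemma mat_trace_similar:
  fixes A B :: "'a :: comm_ring_1 mat"
  assumes "similar_mat_wit A B P Q" and A: "A \<in> carrier_mat n n"
  shows "mat_trace A = mat_trace B"
proof -
  note D = similar_mat_witD2[OF A assms(1)]
  have "mat_trace A = mat_trace (P * (B * Q))" using D by simp
  also have "\<dots> = mat_trace ((B * Q) * P)" using D by (intro mat_trace_mult_commute) auto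
  also have "(B * Q) * P = B" using D by (simp add: assoc_mult_mat[of _ n n _ n _ n])
  finally show ?thesis .
qed

text \<open>In the sum over \<open>l\<close> for the entry \<open>(i, j)\<close>, the left factor
  vanishes for \<open>l < i\<close> by induction and the right one for \<open>j < l\<close>. With
  \<open>j \<le> i\<close> only \<open>l = i = j\<close> survives.\<close>

lemma upper_triangular_pow:
  fixes B :: "'a :: semiring_1 mat"
  assumes B: "B \<in> carrier_mat n n" and tri: "upper_triangular B"
  shows "i < n \<Longrightarrow> j \<le> i \<Longrightarrow> (B ^\<^sub>m k) $$ (i, j) = (if i = j then (B $$ (i, i)) ^ k else 0)"
proof (induction k arbitrary: i j)
  case 0
  then show ?case using B by auto
next
  case (Suc k)
  have term0: "(B ^\<^sub>m k) $$ (i, l) * B $$ (l, j) = 0" if "l < n" "l \<noteq> i \<or> j < i" for l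
  proof (cases "l < i")
    case True
    then show ?thesis using Suc by auto
  next
    case False
    then have "j < l" using that Suc.prems by auto
    then have "B $$ (l, j) = 0" using tri B that by (intro upper_triangularD[of B]) auto
    then show ?thesis by simp
  qed
  have "(B ^\<^sub>m Suc k) $$ (i, j) = (\<Sum>l<n. (B ^\<^sub>m k) $$ (i, l) * B $$ (l, j))"
    using B Suc.prems by (auto simp: scalar_prod_def atLeast0LessThan intro!: sum.cong)
  also have "\<dots> = (\<Sum>l<n. if l = i then (if i = j then (B $$ (i, i)) ^ Suc k else 0) else 0)"
  proof (intro sum.cong refl)
    fix l assume l: "l \<in> {..<n}"
    show "(B ^\<^sub>m k) $$ (i, l) * B $$ (l, j)
        = (if l = i then (if i = j then (B $$ (i, i)) ^ Suc k else 0) else 0)"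
    proof (cases "l = i \<and> i = j")
      case True
      then show ?thesis using Suc.IH[of i i] l by (simp add: power_Suc2 del: power_Suc)
    next
      case False
      then have "l \<noteq> i \<or> j < i" using Suc.prems by auto
      then show ?thesis using term0[of l] l False by auto
    qed
  qed
  also have "\<dots> = (if i = j then (B $$ (i, i)) ^ Suc k else 0)" using Suc.prems by simp
  finally show ?case .
qed

text \<open>The similarity between \<open>A\<close> and its triangular form \<open>B\<close> passes
  to the powers with the same \<open>P\<close> and \<open>Q\<close>, and the diagonal of
  \<open>B\<close> is \<open>es\<close>.\<close>

lemma mat_trace_pow_eq_sum_list:
  fixes A :: "'a :: conjugatable_ordered_field mat"
  assumes A: "A \<in> carrier_mat n n" and fac: "char_poly A = (\<Prod>e\<leftarrow>es. [:- e, 1:])"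
  shows "mat_trace (A ^\<^sub>m k) = (\<Sum>e\<leftarrow>es. e ^ k)"
proof -
  obtain B P Q where "schur_decomposition A es = (B, P, Q)" by (rule prod_cases3)
  from schur_decomposition[OF A fac this]
  have sim: "similar_mat_wit A B P Q" and tri: "upper_triangular B" and diag: "diag_mat B = es"
    by auto
  have B: "B \<in> carrier_mat n n" using similar_mat_witD2[OF A sim] by simp
  have "mat_trace (A ^\<^sub>m k) = mat_trace (B ^\<^sub>m k)"
    using similar_mat_wit_pow[OF sim, of k] A by (intro mat_trace_similar[of _ _ P Q n]) auto
  also have "\<dots> = (\<Sum>i<n. (B $$ (i, i)) ^ k)"
    unfolding mat_trace_def using B upper_triangular_pow[OF B tri] by (intro sum.cong) auto
  also have "\<dots> = (\<Sum>e\<leftarrow>diag_mat B. e ^ k)"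
    using B by (simp add: diag_mat_def o_def sum_list_distinct_conv_sum_set atLeast0LessThan)
  finally show ?thesis by (simp add: diag)
qed

text \<open>Enumerating the eigenvalue multiset reduces the rest to finite sums of reals. The monic
  characteristic polynomial splits over the reals because \<open>size_sombor_eigenvalues\<close>
  provides as many real roots as its degree.\<close>

lemma sombor_spectrum:
  obtains r :: "nat \<Rightarrow> real"
  where "\<And>k. mat_trace (sombor_matrix vs E ^\<^sub>m k) = (\<Sum>i<length vs. r i ^ k)"
    and "sombor_estrada vs E = (\<Sum>i<length vs. exp (r i))"
proof -
  let ?A = "sombor_matrix vs E"
  have A: "?A \<in> carrier_mat (length vs) (length vs)" by (simp add: sombor_matrix_def)
  obtain es where es: "mset es = sombor_eigenvalues vs E" using ex_mset by blast
  have len: "length es = length vs" using size_sombor_eigenvalues es by (metis size_mset)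
  note monic = degree_monic_char_poly[OF A]
  have "char_poly ?A = Polynomial.smult (lead_coeff (char_poly ?A)) (\<Prod>x\<in>#proots (char_poly ?A). [:-x, 1:])"
    using monic size_sombor_eigenvalues[of vs E]
    by (intro poly_eq_prod_proots) (auto simp: sombor_eigenvalues_def)
  also have "\<dots> = (\<Prod>x\<in>#mset es. [:-x, 1:])" using monic by (simp add: es sombor_eigenvalues_def)
  also have "\<dots> = (\<Prod>e\<leftarrow>es. [:- e, 1:])" by (metis mset_map prod_mset_prod_list)
  finally have fac: "char_poly ?A = (\<Prod>e\<leftarrow>es. [:- e, 1:])" .
  have sums: "(\<Sum>e\<leftarrow>es. f e) = (\<Sum>i<length vs. f (es ! i))" for f :: "real \<Rightarrow> real"
    by (simp add: sum_list_sum_nth atLeast0LessThan len)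
  show ?thesis
  proof (rule that[of "(!) es"])
    show "mat_trace (?A ^\<^sub>m k) = (\<Sum>i<length vs. (es ! i) ^ k)" for k
      using mat_trace_pow_eq_sum_list[OF A fac] sums by simp
    have "sombor_estrada vs E = (\<Sum>e\<leftarrow>es. exp e)"
      unfolding sombor_estrada_def es[symmetric] by (metis mset_map sum_mset_sum_list)
    then show "sombor_estrada vs E = (\<Sum>i<length vs. exp (es ! i))" using sums by simp
  qed
qed

section \<open>Graphs\<close>

lemma finite_edges: "simple_graph vs E \<Longrightarrow> finite E"
  unfolding simple_graph_def by (rule finite_subset[of _ "Pow (set vs)"]) auto

text \<open>This passes from incident edges to the indices of a matrix row. The map from
  \<open>j\<close> to the edge is injective because \<open>vs\<close> is distinct, and surjective
  because edges have exactly two elements.\<close>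

lemma degr_eq_card_neighbours:
  assumes "simple_graph vs E" and "i < length vs"
  shows "degr E (vs ! i) = card {j. j < length vs \<and> {vs ! i, vs ! j} \<in> E}"
proof -
  have dist: "distinct vs" and E: "\<And>e. e \<in> E \<Longrightarrow> e \<subseteq> set vs \<and> card e = 2"
    using assms(1) by (auto simp: simple_graph_def)
  have "bij_betw (\<lambda>j. {vs ! i, vs ! j}) {j. j < length vs \<and> {vs ! i, vs ! j} \<in> E}
    {e \<in> E. vs ! i \<in> e}"
  proof (rule bij_betwI')
    fix j k assume "j \<in> {j. j < length vs \<and> {vs ! i, vs ! j} \<in> E}"
      and "k \<in> {j. j < length vs \<and> {vs ! i, vs ! j} \<in> E}"
    then show "({vs ! i, vs ! j} = {vs ! i, vs ! k}) = (j = k)"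
      using dist by (auto simp: doubleton_eq_iff nth_eq_iff_index_eq)
  next
    fix e assume "e \<in> {e \<in> E. vs ! i \<in> e}"
    then have e: "e \<in> E" "vs ! i \<in> e" by auto
    obtain y where y: "e = {vs ! i, y}" using E[OF e(1)] e(2) by (auto simp: card_2_iff)
    then have "y \<in> set vs" using E[OF e(1)] by auto
    then obtain j where "j < length vs" "y = vs ! j" by (auto simp: in_set_conv_nth)
    then show "\<exists>j\<in>{j. j < length vs \<and> {vs ! i, vs ! j} \<in> E}. e = {vs ! i, vs ! j}"
      using e y by auto
  qed auto
  then show ?thesis unfolding degr_def by (simp add: bij_betw_same_card)
qed

lemma mat_trace_sombor:
  assumes "simple_graph vs E"
  shows "mat_trace (sombor_matrix vs E) = 0"
proof -
  have "{v} \<notin> E" for v using assms by (auto simp: simple_graph_def)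
  then show ?thesis by (simp add: mat_trace_def sombor_matrix_def)
qed

text \<open>Each vertex contributes its squared degree once per neighbour, hence its cubed degree.
  The factor 2 arises because an adjacent pair is met in both orders.\<close>

lemma mat_trace_sombor_square:
  assumes G: "simple_graph vs E"
  shows "mat_trace (sombor_matrix vs E ^\<^sub>m 2) = 2 * (\<Sum>i<length vs. real (degr E (vs ! i)) ^ 3)"
proof -
  let ?n = "length vs" and ?A = "sombor_matrix vs E"
  define d where "d i = real (degr E (vs ! i))" for i
  define N where "N i = {j. j < ?n \<and> {vs ! i, vs ! j} \<in> E}" for i
  have A: "?A \<in> carrier_mat ?n ?n" by (simp add: sombor_matrix_def)
  have entry: "?A $$ (i, j) * ?A $$ (j, i) = (if j \<in> N i then (d i)\<^sup>2 + (d j)\<^sup>2 else 0)"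
    if "i < ?n" "j < ?n" for i j
    using that by (simp add: sombor_matrix_def N_def d_def insert_commute add.commute)
  have sym: "j \<in> N i \<longleftrightarrow> i \<in> N j" if "i < ?n" "j < ?n" for i j
    using that by (simp add: N_def insert_commute)
  have half: "(\<Sum>j<?n. if j \<in> N i then (d i)\<^sup>2 else 0) = d i ^ 3" if "i < ?n" for i
  proof -
    have "{..<?n} \<inter> N i = N i" by (auto simp: N_def)
    then have "(\<Sum>j<?n. if j \<in> N i then (d i)\<^sup>2 else 0) = real (card (N i)) * (d i)\<^sup>2"
      by (simp flip: sum.inter_restrict)
    then show ?thesis using degr_eq_card_neighbours[OF G that]
      by (simp add: d_def N_def power2_eq_square power3_eq_cube)
  qed
  have "mat_trace (?A ^\<^sub>m 2) = (\<Sum>i<?n. \<Sum>j<?n. ?A $$ (i, j) * ?A $$ (j, i))"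
    using A by (auto simp: numeral_2_eq_2 mat_trace_def scalar_prod_def atLeast0LessThan
        intro!: sum.cong)
  \<comment> \<open>Writing the second condition as \<open>i \<in> N j\<close> makes the second
    double sum the first one with the summations exchanged.\<close>
  also have "\<dots> = (\<Sum>i<?n. \<Sum>j<?n. (if j \<in> N i then (d i)\<^sup>2 else 0) + (if i \<in> N j then (d j)\<^sup>2 else 0))"
    by (intro sum.cong refl) (auto simp: entry sym)
  also have "\<dots> = (\<Sum>i<?n. \<Sum>j<?n. if j \<in> N i then (d i)\<^sup>2 else 0)
      + (\<Sum>i<?n. \<Sum>j<?n. if i \<in> N j then (d j)\<^sup>2 else 0)"
    by (simp add: sum.distrib)
  also have "(\<Sum>i<?n. \<Sum>j<?n. if i \<in> N j then (d j)\<^sup>2 else 0)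
      = (\<Sum>i<?n. \<Sum>j<?n. if j \<in> N i then (d i)\<^sup>2 else 0)"
    by (rule sum.swap)
  also have "(\<Sum>i<?n. \<Sum>j<?n. if j \<in> N i then (d i)\<^sup>2 else 0) = (\<Sum>i<?n. d i ^ 3)"
    using half by simp
  finally show ?thesis by (simp add: d_def)
qed

lemma sum_degr_cubes_pos:
  assumes G: "simple_graph vs E" and "E \<noteq> {}"
  shows "0 < (\<Sum>i<length vs. real (degr E (vs ! i)) ^ 3)"
proof -
  obtain e where e: "e \<in> E" using \<open>E \<noteq> {}\<close> by blast
  then obtain v where v: "v \<in> e" "v \<in> set vs"
    using G by (fastforce simp: simple_graph_def card_2_iff)
  then obtain i where i: "i < length vs" "v = vs ! i" by (auto simp: in_set_conv_nth)
  \<comment> \<open>Finiteness of \<open>E\<close> matters here, since \<open>card\<close> is 0 on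
    infinite sets.\<close>
  have "degr E (vs ! i) > 0"
    using e v i finite_edges[OF G] by (auto simp: degr_def card_gt_0_iff)
  then show ?thesis using i by (intro sum_pos2[of _ i]) auto
qed

section \<open>The tail of the exponential series\<close>

text \<open>The cut is after degree 4: the power sums of degrees 0, 1 and 2 are known, and those of
  degrees 3 and 4 stay in the bound as traces.\<close>

definition exp_tail5 :: "real \<Rightarrow> real" where
  "exp_tail5 x = exp x - 1 - x - x\<^sup>2 / 2 - x ^ 3 / 6 - x ^ 4 / 24"

lemma exp_tail5_sums: "(\<lambda>k. x ^ (k + 5) / fact (k + 5)) sums exp_tail5 x"
proof -
  have "(\<lambda>k. x ^ k / fact k) sums exp x"
    using exp_converges[of x] by (simp add: divide_inverse mult.commute)
  from sums_split_initial_segment[OF this, of 5] show ?thesis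
    by (simp add: exp_tail5_def eval_nat_numeral algebra_simps)
qed

text \<open>Only two factors of \<open>x\<close> are kept, because the squares of the eigenvalues
  have a known sum. The remaining odd or even power is bounded through
  \<open>\<bar>x\<bar>\<close>.\<close>

lemma power_add5_le:
  fixes x s :: real
  assumes "\<bar>x\<bar> \<le> s"
  shows "s\<^sup>2 * x ^ (k + 5) \<le> x\<^sup>2 * s ^ (k + 5)"
proof -
  have "x ^ (k + 3) \<le> \<bar>x\<bar> ^ (k + 3)" by (metis abs_ge_self power_abs)
  also have "\<dots> \<le> s ^ (k + 3)" using assms by (intro power_mono) auto
  finally have "(s\<^sup>2 * x\<^sup>2) * x ^ (k + 3) \<le> (s\<^sup>2 * x\<^sup>2) * s ^ (k + 3)" by (rule mult_left_mono) auto
  then show ?thesis by (simp add: power_add power2_eq_square eval_nat_numeral mult_ac)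
qed

lemma exp_tail5_diff_sums:
  "(\<lambda>k. (x\<^sup>2 * s ^ (k + 5) - s\<^sup>2 * x ^ (k + 5)) / fact (k + 5)) sums (x\<^sup>2 * exp_tail5 s - s\<^sup>2 * exp_tail5 x)"
  using sums_diff[OF sums_mult[OF exp_tail5_sums[of s], of "x\<^sup>2"] sums_mult[OF exp_tail5_sums[of x], of "s\<^sup>2"]]
  by (simp add: diff_divide_distrib)

lemma exp_tail5_le:
  assumes "\<bar>x\<bar> \<le> s"
  shows "s\<^sup>2 * exp_tail5 x \<le> x\<^sup>2 * exp_tail5 s"
proof -
  have "0 \<le> x\<^sup>2 * exp_tail5 s - s\<^sup>2 * exp_tail5 x"
    using power_add5_le[OF assms] by (intro sums_le[OF _ sums_zero exp_tail5_diff_sums]) auto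
  then show ?thesis by simp
qed

lemma exp_tail5_less:
  assumes "\<bar>x\<bar> \<le> s" and "x < 0"
  shows "s\<^sup>2 * exp_tail5 x < x\<^sup>2 * exp_tail5 s"
proof -
  let ?f = "\<lambda>k. (x\<^sup>2 * s ^ (k + 5) - s\<^sup>2 * x ^ (k + 5)) / fact (k + 5)"
  have "s > 0" using assms by linarith
  \<comment> \<open>Index 0 of \<open>?f\<close> carries the odd exponent 5, so a negative
    \<open>x\<close> makes this term positive; all other terms are nonnegative.\<close>
  have "x ^ 5 < 0" using assms(2) by (simp add: power_less_zero_eq)
  then have "s\<^sup>2 * x ^ 5 < 0" using \<open>s > 0\<close> by (simp add: mult_pos_neg)
  moreover have "0 \<le> x\<^sup>2 * s ^ 5" using \<open>s > 0\<close> by simp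
  ultimately have "0 < ?f 0" by simp
  then have "0 < suminf ?f"
    using power_add5_le[OF assms(1)] sums_summable[OF exp_tail5_diff_sums]
    by (intro suminf_pos2[of ?f 0]) auto
  then show ?thesis using sums_unique[OF exp_tail5_diff_sums[of x s]] by simp
qed

lemma exists_neg_if_sum_zero:
  fixes f :: "'i \<Rightarrow> real"
  assumes "finite I" and "sum f I = 0" and "(\<Sum>i\<in>I. (f i)\<^sup>2) \<noteq> 0"
  obtains i where "i \<in> I" and "f i < 0"
proof -
  have "\<exists>i\<in>I. f i < 0"
  proof (rule ccontr)
    assume "\<not> (\<exists>i\<in>I. f i < 0)"
    then have "\<forall>i\<in>I. f i = 0" using assms(1,2) by (subst (asm) sum_nonneg_eq_0_iff) auto
    then show False using assms(3) by simp
  qed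
  then show ?thesis using that by blast
qed

lemma sum_exp_tail5_less:
  fixes f :: "'i \<Rightarrow> real"
  assumes I: "finite I" and "sum f I = 0" and sq: "(\<Sum>i\<in>I. (f i)\<^sup>2) = s\<^sup>2" and "s > 0"
  shows "(\<Sum>i\<in>I. exp_tail5 (f i)) < exp_tail5 s"
proof -
  have bound: "\<bar>f i\<bar> \<le> s" if "i \<in> I" for i
  proof -
    have "(f i)\<^sup>2 \<le> s\<^sup>2" unfolding sq[symmetric] using I that by (intro member_le_sum) auto
    then show ?thesis using \<open>s > 0\<close> by (simp add: abs_le_square_iff[symmetric])
  qed
  obtain i where i: "i \<in> I" "f i < 0"
    using exists_neg_if_sum_zero[OF I assms(2)] sq \<open>s > 0\<close> by auto
  have "(\<Sum>i\<in>I. s\<^sup>2 * exp_tail5 (f i)) < (\<Sum>i\<in>I. (f i)\<^sup>2 * exp_tail5 s)"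
    using I bound exp_tail5_le exp_tail5_less[OF bound[OF i(1)] i(2)] i(1)
    by (intro sum_strict_mono_ex1) blast+
  \<comment> \<open>On the right the weights \<open>(f i)\<^sup>2\<close> add up to
    \<open>s\<^sup>2\<close>, which then cancels.\<close>
  then have "s\<^sup>2 * (\<Sum>i\<in>I. exp_tail5 (f i)) < s\<^sup>2 * exp_tail5 s"
    by (simp add: sum_distrib_left sq flip: sum_distrib_right)
  then show ?thesis using \<open>s > 0\<close> by simp
qed

section \<open>The bound\<close>

theorem theorem5p1:
  fixes vs :: "'a list" and E :: "'a set set" and n m :: nat and S :: "real mat" and F :: real
  assumes "simple_graph vs E"
    and "length vs = n" and "card E = m"
    and "S = sombor_matrix vs E"
    and "F = (\<Sum>i<n. real (degr E (vs ! i)) ^ 3)"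
  shows "(sombor_estrada vs E
           \<le> real n - 1 + mat_trace (S ^\<^sub>m 3) / 6 + mat_trace (S ^\<^sub>m 4) / 24
             + exp (sqrt (2 * F)) - sqrt (2 * F) - 1 / 3 * F * sqrt (2 * F) - 1 / 6 * F\<^sup>2) \<and>
         (sombor_estrada vs E
           = real n - 1 + mat_trace (S ^\<^sub>m 3) / 6 + mat_trace (S ^\<^sub>m 4) / 24
             + exp (sqrt (2 * F)) - sqrt (2 * F) - 1 / 3 * F * sqrt (2 * F) - 1 / 6 * F\<^sup>2
         \<longleftrightarrow> E = {})"
proof -
  obtain r :: "nat \<Rightarrow> real" where tr: "\<And>k. mat_trace (S ^\<^sub>m k) = (\<Sum>i<n. r i ^ k)"
    and ee: "sombor_estrada vs E = (\<Sum>i<n. exp (r i))"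
    using sombor_spectrum[of vs E] assms(2,4) by metis
  define s where "s = sqrt (2 * F)"
  have "F \<ge> 0" unfolding assms(5) by (intro sum_nonneg) auto
  then have s2: "s\<^sup>2 = 2 * F" by (simp add: s_def)
  have S: "S \<in> carrier_mat n n" using assms(2,4) by (simp add: sombor_matrix_def)
  have tr1: "(\<Sum>i<n. r i) = 0"
    using tr[of 1] mat_trace_sombor[OF assms(1)] S assms(4) by simp
  have tr2: "(\<Sum>i<n. (r i)\<^sup>2) = s\<^sup>2"
    using tr[of 2] mat_trace_sombor_square[OF assms(1)] assms(2,4,5) s2 by simp
  have "(\<Sum>i<n. exp_tail5 (r i))
      = sombor_estrada vs E - n - F - mat_trace (S ^\<^sub>m 3) / 6 - mat_trace (S ^\<^sub>m 4) / 24"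
    by (simp add: exp_tail5_def sum_subtractf ee tr tr1 tr2 s2 flip: sum_divide_distrib)
  moreover have "s ^ 3 = 2 * F * s" "s ^ 4 = 4 * F\<^sup>2"
    using s2 by (simp_all add: power3_eq_cube power4_eq_xxxx power2_eq_square algebra_simps)
  then have "exp_tail5 s = exp s - 1 - s - F - 1 / 3 * F * s - 1 / 6 * F\<^sup>2"
    by (simp add: exp_tail5_def s2)
  \<comment> \<open>The quadratic terms contribute \<open>F\<close> to both tails, so it cancels,
    and the gap in the claimed bound is exactly the gap between the tails.\<close>
  ultimately have gap: "real n - 1 + mat_trace (S ^\<^sub>m 3) / 6 + mat_trace (S ^\<^sub>m 4) / 24
      + exp s - s - 1 / 3 * F * s - 1 / 6 * F\<^sup>2 - sombor_estrada vs E
      = exp_tail5 s - (\<Sum>i<n. exp_tail5 (r i))"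
    by simp
  show ?thesis
  \<comment> \<open>Without edges all eigenvalues and \<open>s\<close> are 0, so both tails vanish.
    With an edge the strict inequality gives the bound and excludes equality at once.\<close>
  proof (cases "E = {}")
    case True
    then have "F = 0" by (simp add: assms(5) degr_def)
    then have "s = 0" by (simp add: s_def)
    then have "\<forall>i<n. r i = 0" using tr2 by (simp add: sum_nonneg_eq_0_iff)
    then have "exp_tail5 s = (\<Sum>i<n. exp_tail5 (r i))"
      using \<open>s = 0\<close> by (simp add: exp_tail5_def)
    then show ?thesis using gap True unfolding s_def by simp
  next
    case False
    then have "s > 0" using sum_degr_cubes_pos[OF assms(1)] assms(2,5) by (simp add: s_def)
    then have "(\<Sum>i<n. exp_tail5 (r i)) < exp_tail5 s"
      using tr1 tr2 by (intro sum_exp_tail5_less) auto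
    then show ?thesis using gap False unfolding s_def by simp
  qed
qed

end
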